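(* Let $F$ be a nonsingular unsatisfiable hitting clause-set and let $F'$ be obtained from $F$ by one nfs-flip. Then $\mathrm{singind}(F')\le 1$. Moreover, if $F$ is not fs-resolvable and $\mathrm{singind}(F')=1$, and $G:=\mathrm{sNF}(F')$, then there is a nontrivial clause-factorisation $G=(G_0,C)\diamond H$ such that $\mathrm{var}(G_0)\cap\mathrm{var}(H)\ne\emptyset$.
   Context: Variables are positive integers, literals are nonzero integers, the complement of $x$ is $\overline{x}=-x$, $\mathrm{var}(x)=|x|$. A clause is a finite set of literals with no pair $x,\overline{x}$; $\bot$ is the empty clause. A clause-set is a finite set of clauses; $\mathrm{var}(F)$ is the set of variables occurring in $F$. $F$ is satisfiable if some clause meets every clause of $F$, otherwise unsatisfiable. $F$ is hitting if any two distinct clauses $C,D\in F$ have some $x\in C$ with $\overline{x}\in D$. $\mathrm{ldeg}_F(x)$ is the number of clauses containing $x$; $v\in\mathrm{var}(F)$ is singular if $\min(\mathrm{ldeg}_F(v),\mathrm{ldeg}_F(\overline v))=1$; $F$ is nonsingular if it has none. For a singular variable $v$, singular DP-reduction replaces $F$ by $\mathrm{DP}_v(F):=\{(A\cup B)\setminus\{v,\overline v\}: A,B\in F, A\cap\overline{B}=\{v\}\}\cup\{A\in F: v\notin\mathrm{var}(A)\}$. For an unsatisfiable hitting clause-set $F$, iterating singular DP-reductions until no singular variable remains always yields the same clause-set $\mathrm{sNF}(F)$ after the same number $\mathrm{singind}(F)$ of steps. An nfs-pair is $\{E\cup\{x\},E\cup\{\overline{x},y\}\}$ with $E$ a clause,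 $\mathrm{var}(x)\ne\mathrm{var}(y)$, $x,\overline x,y,\overline y\notin E$; its nfs-flip is $\{E\cup\{x,\overline y\},E\cup\{y\}\}$. An nfs-flip on $F$ replaces an nfs-pair $P\subseteq F$, neither of whose flip clauses lies in $F$, by its nfs-flip. An fs-pair is $\{E\cup\{v\},E\cup\{\overline v\}\}$ with $v,\overline v\notin E$; $F$ is fs-resolvable if it contains an fs-pair $\{E\cup\{v\},E\cup\{\overline v\}\}$ with $E\notin F$. For clause-sets $G_0,H$ and $C\in G_0$, $(G_0,C)\diamond H:=(G_0\setminus\{C\})\cup\{C\cup D: D\in H, C\cap\overline D=\emptyset\}$; this is a clause-factorisation if $\mathrm{var}(C)\cap\mathrm{var}(H)=\emptyset$, the union is disjoint, and $H$ is unsatisfiable; it is nontrivial if $G_0\ne\{\bot\}$ and $H\ne\{\bot\}$. *)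

theory Defs
  imports Main
begin

type_synonym lit = int
type_synonym cls = "int set"
type_synonym clsset = "int set set"

definition is_lit :: "lit \<Rightarrow> bool" where
  "is_lit x \<longleftrightarrow> x \<noteq> 0"

definition compl :: "cls \<Rightarrow> cls" where
  "compl C = uminus ` C"

definition is_clause :: "cls \<Rightarrow> bool" where
  "is_clause C \<longleftrightarrow> finite C \<and> (\<forall>x\<in>C. is_lit x) \<and> C \<inter> compl C = {}"

definition is_clause_set :: "clsset \<Rightarrow> bool" where
  "is_clause_set F \<longleftrightarrow> finite F \<and> (\<forall>C\<in>F. is_clause C)"

text \<open>Variables are the positive integers; the variable of a literal is its absolute value.\<close>

definition var_cl :: "cls \<Rightarrow> int set" where
  "var_cl C = abs ` C"

definition var_cls :: "clsset \<Rightarrow> int set" where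
  "var_cls F = (\<Union>C\<in>F. var_cl C)"

definition satisfiable :: "clsset \<Rightarrow> bool" where
  "satisfiable F \<longleftrightarrow> (\<exists>M. is_clause M \<and> (\<forall>C\<in>F. M \<inter> C \<noteq> {}))"

definition hitting :: "clsset \<Rightarrow> bool" where
  "hitting F \<longleftrightarrow> (\<forall>C\<in>F. \<forall>D\<in>F. C \<noteq> D \<longrightarrow> (\<exists>x\<in>C. - x \<in> D))"

definition ldeg :: "clsset \<Rightarrow> lit \<Rightarrow> nat" where
  "ldeg F x = card {C \<in> F. x \<in> C}"

definition singular_var :: "clsset \<Rightarrow> int \<Rightarrow> bool" where
  "singular_var F v \<longleftrightarrow> v \<in> var_cls F \<and> min (ldeg F v) (ldeg F (- v)) = 1"

definition nonsingular :: "clsset \<Rightarrow> bool" where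
  "nonsingular F \<longleftrightarrow> \<not> (\<exists>v. singular_var F v)"

definition DP :: "int \<Rightarrow> clsset \<Rightarrow> clsset" where
  "DP v F = {(A \<union> B) - {v, - v} | A B. A \<in> F \<and> B \<in> F \<and> A \<inter> compl B = {v}}
            \<union> {A \<in> F. v \<notin> var_cl A}"

definition sDP_step :: "clsset \<Rightarrow> clsset \<Rightarrow> bool" where
  "sDP_step F F' \<longleftrightarrow> (\<exists>v. singular_var F v \<and> F' = DP v F)"

text \<open>On unsatisfiable hitting clause-sets, all maximal sequences of singular DP-reductions
  end in the same clause-set and have the same length, so both descriptions below are
  meaningful there; elsewhere the values may be unspecified.\<close>

definition sNF :: "clsset \<Rightarrow> clsset" where
  "sNF F = (THE G. sDP_step\<^sup>*\<^sup>* F G \<and> nonsingular G)"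

definition singind :: "clsset \<Rightarrow> nat" where
  "singind F = (THE n. \<exists>G. (sDP_step ^^ n) F G \<and> nonsingular G)"

definition nfs_cond :: "cls \<Rightarrow> lit \<Rightarrow> lit \<Rightarrow> bool" where
  "nfs_cond E x y \<longleftrightarrow> is_clause E \<and> is_lit x \<and> is_lit y \<and> \<bar>x\<bar> \<noteq> \<bar>y\<bar> \<and>
     x \<notin> E \<and> - x \<notin> E \<and> y \<notin> E \<and> - y \<notin> E"

definition nfs_pair :: "cls \<Rightarrow> lit \<Rightarrow> lit \<Rightarrow> clsset" where
  "nfs_pair E x y = {E \<union> {x}, E \<union> {- x, y}}"

definition nfs_flip_pair :: "cls \<Rightarrow> lit \<Rightarrow> lit \<Rightarrow> clsset" where
  "nfs_flip_pair E x y = {E \<union> {x, - y}, E \<union> {y}}"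

definition nfs_flip :: "clsset \<Rightarrow> clsset \<Rightarrow> bool" where
  "nfs_flip F F' \<longleftrightarrow> (\<exists>E x y. nfs_cond E x y \<and> nfs_pair E x y \<subseteq> F \<and>
     nfs_flip_pair E x y \<inter> F = {} \<and> F' = (F - nfs_pair E x y) \<union> nfs_flip_pair E x y)"

definition fs_resolvable :: "clsset \<Rightarrow> bool" where
  "fs_resolvable F \<longleftrightarrow> (\<exists>E v. is_clause E \<and> is_lit v \<and> v \<notin> E \<and> - v \<notin> E \<and>
     {E \<union> {v}, E \<union> {- v}} \<subseteq> F \<and> E \<notin> F)"

definition clause_prod_part :: "cls \<Rightarrow> clsset \<Rightarrow> clsset" where
  "clause_prod_part C H = {C \<union> D | D. D \<in> H \<and> C \<inter> compl D = {}}"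

text \<open>The product \<open>(G0, C) \<diamond> H\<close>.\<close>

definition clause_prod :: "clsset \<Rightarrow> cls \<Rightarrow> clsset \<Rightarrow> clsset" where
  "clause_prod G0 C H = (G0 - {C}) \<union> clause_prod_part C H"

definition clause_factorisation :: "clsset \<Rightarrow> cls \<Rightarrow> clsset \<Rightarrow> bool" where
  "clause_factorisation G0 C H \<longleftrightarrow>
     is_clause_set G0 \<and> is_clause_set H \<and> C \<in> G0 \<and>
     var_cl C \<inter> var_cls H = {} \<and> (G0 - {C}) \<inter> clause_prod_part C H = {} \<and>
     \<not> satisfiable H"

definition nontrivial_clause_factorisation :: "clsset \<Rightarrow> cls \<Rightarrow> clsset \<Rightarrow> bool" where
  "nontrivial_clause_factorisation G0 C H \<longleftrightarrow>
     clause_factorisation G0 C H \<and> G0 \<noteq> {{}} \<and> H \<noteq> {{}}"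

end

theory Submission
  imports Defs
begin

text \<open>
  In an unsatisfiable hitting clause-set every total assignment falsifies exactly one clause.
  An nfs-flip keeps this property and only decreases the degree of the literal \<open>- x\<close>; hence
  \<open>F'\<close> is nonsingular unless \<open>- x\<close> is left with a single occurrence, in a clause
  \<open>P = K \<union> {- x}\<close>. Flipping \<open>x\<close> in assignments falsifying a clause \<open>A\<close> with \<open>x \<in> A\<close> shows
  \<open>K \<subseteq> A\<close>, so DP-reduction just drops \<open>P\<close> and removes \<open>x\<close> from the clauses \<open>A\<close>. The result is
  nonsingular, and it factors as \<open>(G0, K) \<diamond> H\<close>, where \<open>H\<close> consists of the clauses
  \<open>A - {x} - K\<close>. Since \<open>P\<close> must clash with \<open>E \<union> {- x, y}\<close>, we have \<open>K \<subseteq> E \<union> {- y}\<close> with \<open>- y \<in> K\<close>;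
  moreover \<open>E\<close> is not contained in \<open>K\<close>, since otherwise \<open>E \<union> {x, - y}\<close> would be a subset of every other
  clause containing \<open>x\<close>. The variable of a literal in \<open>E - K\<close> is then shared by \<open>E \<union> {y} \<in> G0\<close> and \<open>E - K \<in> H\<close>.
\<close>

section \<open>Total assignments and falsified clauses\<close>

definition lit_true :: "(int \<Rightarrow> bool) \<Rightarrow> lit \<Rightarrow> bool" where
  "lit_true t z \<longleftrightarrow> (if 0 < z then t z else \<not> t (- z))"

definition falsifies :: "(int \<Rightarrow> bool) \<Rightarrow> cls \<Rightarrow> bool" where
  "falsifies t C \<longleftrightarrow> (\<forall>z\<in>C. \<not> lit_true t z)"

text \<open>For a clause \<open>C\<close> this is the modification of \<open>t\<close> that makes
  every literal of \<open>C\<close> false and changes nothing outside the variables of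
  \<open>C\<close>.\<close>

definition override :: "cls \<Rightarrow> (int \<Rightarrow> bool) \<Rightarrow> int \<Rightarrow> bool" where
  "override C t = (\<lambda>v. if v \<in> C then False else if - v \<in> C then True else t v)"

text \<open>Semantic form of "unsatisfiable and hitting": existence encodes unsatisfiability,
  uniqueness the clashes. It can be checked assignment by assignment, which suits flips.\<close>

definition uhit :: "clsset \<Rightarrow> bool" where
  "uhit F \<longleftrightarrow> is_clause_set F \<and> (\<forall>t. \<exists>!C. C \<in> F \<and> falsifies t C)"

lemma is_clauseD:
  assumes "is_clause C" "z \<in> C"
  shows "z \<noteq> 0" "- z \<notin> C"
  using assms by (auto simp: is_clause_def is_lit_def compl_def image_iff)

lemma is_clauseI:
  assumes "finite C" "\<And>z. z \<in> C \<Longrightarrow> z \<noteq> 0" "\<And>z. z \<in> C \<Longrightarrow> - z \<notin> C"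
  shows "is_clause C"
  using assms by (auto simp: is_clause_def is_lit_def compl_def image_iff)

lemma is_clause_subset: "is_clause C \<Longrightarrow> D \<subseteq> C \<Longrightarrow> is_clause D"
  by (rule is_clauseI) (metis finite_subset is_clause_def, metis is_clauseD(1) subsetD, metis is_clauseD(2) subsetD)

lemma is_clause_singleton: "z \<noteq> 0 \<Longrightarrow> is_clause {z}"
  by (rule is_clauseI) auto

lemma lit_true_uminus: "z \<noteq> 0 \<Longrightarrow> lit_true t (- z) \<longleftrightarrow> \<not> lit_true t z"
  by (auto simp: lit_true_def)

lemma lit_true_override:
  assumes "is_clause C" "z \<noteq> 0"
  shows "lit_true (override C t) z \<longleftrightarrow> z \<notin> C \<and> (- z \<in> C \<or> lit_true t z)"
  using assms is_clauseD(2)[OF assms(1), of z] is_clauseD(2)[OF assms(1), of "- z"]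
  by (auto simp: lit_true_def override_def)

lemma falsifies_override: "is_clause C \<Longrightarrow> falsifies (override C t) C"
  by (simp add: falsifies_def lit_true_override is_clauseD(1))

lemma falsifies_subset: "falsifies t C \<Longrightarrow> D \<subseteq> C \<Longrightarrow> falsifies t D"
  by (auto simp: falsifies_def)

text \<open>Passes between satisfying clauses and total assignments. An assignment falsifying no
  clause yields its true literals, cut down to those occurring in \<open>F\<close> for finiteness; a
  satisfying clause \<open>M\<close> yields its membership predicate.\<close>

lemma unsatisfiable_iff_falsifies:
  assumes "is_clause_set F"
  shows "\<not> satisfiable F \<longleftrightarrow> (\<forall>t. \<exists>C\<in>F. falsifies t C)"
proof
  assume unsat: "\<not> satisfiable F"
  show "\<forall>t. \<exists>C\<in>F. falsifies t C"
  proof (rule allI, rule ccontr)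
    fix t
    assume none: "\<not> (\<exists>C\<in>F. falsifies t C)"
    let ?M = "{z \<in> \<Union>F. lit_true t z}"
    have nz: "z \<noteq> 0" if "z \<in> ?M" for z
      using that assms by (auto simp: is_clause_set_def dest: is_clauseD)
    have "is_clause ?M"
    proof (rule is_clauseI)
      show "finite ?M" using assms by (auto simp: is_clause_set_def is_clause_def)
    next
      fix z assume "z \<in> ?M"
      then show "z \<noteq> 0" "- z \<notin> ?M" using nz lit_true_uminus by blast+
    qed
    moreover have "\<forall>C\<in>F. ?M \<inter> C \<noteq> {}"
      using none by (fastforce simp: falsifies_def)
    ultimately show False using unsat unfolding satisfiable_def by blast
  qed
next
  assume all: "\<forall>t. \<exists>C\<in>F. falsifies t C"
  show "\<not> satisfiable F"
  proof
    assume "satisfiable F"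
    then obtain M where M: "is_clause M" "\<forall>C\<in>F. M \<inter> C \<noteq> {}"
      by (auto simp: satisfiable_def)
    obtain C where C: "C \<in> F" "falsifies (\<lambda>v. v \<in> M) C" using all by blast
    obtain z where z: "z \<in> M" "z \<in> C" using M(2) C(1) by blast
    then have "lit_true (\<lambda>v. v \<in> M) z"
      using is_clauseD[OF M(1)] by (auto simp: lit_true_def)
    then show False using C(2) z(2) by (auto simp: falsifies_def)
  qed
qed

section \<open>Unsatisfiable hitting clause-sets\<close>

lemma hitting_falsified_unique:
  assumes "is_clause_set F" "hitting F" "C \<in> F" "D \<in> F" "falsifies t C" "falsifies t D"
  shows "C = D"
proof (rule ccontr)
  assume "C \<noteq> D"
  then obtain z where z: "z \<in> C" "- z \<in> D" using assms by (auto simp: hitting_def)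
  then have "z \<noteq> 0" using assms by (auto simp: is_clause_set_def dest: is_clauseD)
  then show False using z assms lit_true_uminus by (auto simp: falsifies_def)
qed

lemma uhit_if_unsatisfiable_hitting:
  assumes "is_clause_set F" "\<not> satisfiable F" "hitting F"
  shows "uhit F"
  using assms hitting_falsified_unique[OF assms(1,3)]
  by (auto simp: uhit_def unsatisfiable_iff_falsifies)

lemma uhit_is_clause: "uhit F \<Longrightarrow> C \<in> F \<Longrightarrow> is_clause C"
  by (auto simp: uhit_def is_clause_set_def)

lemma uhit_falsified_unique:
  "uhit F \<Longrightarrow> C \<in> F \<Longrightarrow> D \<in> F \<Longrightarrow> falsifies t C \<Longrightarrow> falsifies t D \<Longrightarrow> C = D"
  unfolding uhit_def by blast

lemma uhit_ex_falsified: "uhit F \<Longrightarrow> \<exists>C\<in>F. falsifies t C"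
  unfolding uhit_def by blast

text \<open>Any assignment falsifying the larger clause also falsifies the smaller one.\<close>

lemma uhit_subset_eq:
  assumes "uhit F" "C \<in> F" "D \<in> F" "C \<subseteq> D"
  shows "C = D"
  using assms falsifies_override[OF uhit_is_clause[OF assms(1,3)]]
  by (meson falsifies_subset uhit_falsified_unique)

text \<open>Make \<open>z\<close> true and take the clause \<open>D\<close> falsified then. Without
  \<open>- z\<close>, it would be falsified by \<open>t\<close> already, hence equal
  \<open>C\<close> and contain the true literal \<open>z\<close>.\<close>

lemma uhit_flip_literal:
  assumes F: "uhit F" and C: "C \<in> F" "z \<in> C" "falsifies t C"
  shows "\<exists>D\<in>F. - z \<in> D \<and> falsifies t (D - {- z})"
proof -
  have z: "z \<noteq> 0" using F C by (auto dest: uhit_is_clause is_clauseD)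
  have cl: "is_clause {- z}" using z by (simp add: is_clause_singleton)
  obtain D where D: "D \<in> F" "falsifies (override {- z} t) D"
    using uhit_ex_falsified[OF F] by blast
  have nz: "w \<noteq> 0" if "w \<in> D" for w
    using F D(1) that by (auto dest: uhit_is_clause is_clauseD)
  have rest: "falsifies t (D - {- z})"
    using D(2) by (auto simp: falsifies_def lit_true_override[OF cl nz])
  have "- z \<in> D"
  proof (rule ccontr)
    assume no: "- z \<notin> D"
    then have "falsifies t D" using rest by simp
    then have "D = C" using uhit_falsified_unique[OF F D(1) C(1) _ C(3)] by blast
    then have "z \<in> D" using C(2) by simp
    then have "\<not> lit_true (override {- z} t) z" using D(2) by (auto simp: falsifies_def)
    then show False using lit_true_override[OF cl z] z by auto
  qed
  then show ?thesis using D(1) rest by blast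
qed

lemma uhit_complement_occurs:
  assumes "uhit F" "C \<in> F" "z \<in> C"
  shows "\<exists>D\<in>F. - z \<in> D"
  using uhit_flip_literal[OF assms falsifies_override[OF uhit_is_clause[OF assms(1,2)]]] by blast

section \<open>Literal degrees and singular variables\<close>

lemma ldeg_eq_1_iff: "ldeg F z = 1 \<longleftrightarrow> (\<exists>!C. C \<in> F \<and> z \<in> C)"
proof -
  have "(\<exists>C. S = {C}) \<longleftrightarrow> (\<exists>!C. C \<in> S)" for S :: clsset
    by blast
  from this[of "{C \<in> F. z \<in> C}"] show ?thesis
    by (simp add: ldeg_def card_1_singleton_iff)
qed

lemma ldeg_pos: "finite F \<Longrightarrow> C \<in> F \<Longrightarrow> z \<in> C \<Longrightarrow> ldeg F z \<ge> 1"
  by (auto simp: ldeg_def Suc_le_eq card_gt_0_iff)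

lemma singular_varD: "singular_var F v \<Longrightarrow> v \<ge> 0 \<and> (ldeg F v = 1 \<or> ldeg F (- v) = 1)"
  by (auto simp: singular_var_def var_cls_def var_cl_def min_def split: if_splits)

text \<open>The minimum in \<open>singular_var\<close> cannot drop to 0, because the complement of
  an occurring literal occurs too.\<close>

lemma uhit_singular_varI:
  assumes F: "uhit F" and deg: "ldeg F z = 1"
  shows "singular_var F \<bar>z\<bar>"
proof -
  obtain C where C: "C \<in> F" "z \<in> C" using deg ldeg_eq_1_iff by blast
  obtain D where D: "D \<in> F" "- z \<in> D" using uhit_complement_occurs[OF F C] by blast
  have "finite F" using F by (auto simp: uhit_def is_clause_set_def)
  then have "ldeg F (- z) \<ge> 1" using D ldeg_pos by blast
  moreover have "\<bar>z\<bar> \<in> var_cls F" using C by (auto simp: var_cls_def var_cl_def)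
  ultimately show ?thesis using deg by (auto simp: singular_var_def abs_if)
qed

lemma nonsingularI: "(\<And>z. ldeg F z \<noteq> 1) \<Longrightarrow> nonsingular F"
  using singular_varD unfolding nonsingular_def by blast

lemma nonsingular_second_occurrence:
  assumes "uhit F" "nonsingular F" "C \<in> F" "z \<in> C"
  shows "\<exists>D\<in>F. D \<noteq> C \<and> z \<in> D"
  using assms uhit_singular_varI ldeg_eq_1_iff unfolding nonsingular_def by metis

section \<open>Effect of an nfs-flip\<close>

lemma nfs_flip_uhit:
  assumes F: "uhit F" and cond: "nfs_cond E x y" and pair: "nfs_pair E x y \<subseteq> F"
  shows "uhit ((F - nfs_pair E x y) \<union> nfs_flip_pair E x y)" (is "uhit ?F'")
proof -
  have E: "is_clause E" and x: "x \<noteq> 0" and y: "y \<noteq> 0" "y \<noteq> x" "y \<noteq> - x"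
    and notin: "x \<notin> E" "- x \<notin> E" "y \<notin> E" "- y \<notin> E"
    using cond by (auto simp: nfs_cond_def is_lit_def)
  have fin: "finite E" using E by (simp add: is_clause_def)
  have "is_clause (E \<union> {x, - y})" "is_clause (E \<union> {y})"
    using x y notin fin is_clauseD[OF E] by (auto intro!: is_clauseI)
  then have "is_clause_set ?F'"
    using F by (auto simp: uhit_def is_clause_set_def nfs_flip_pair_def)
  moreover have "\<exists>!C. C \<in> ?F' \<and> falsifies t C" for t
  proof -
    have one: "\<exists>!C. C \<in> F \<and> falsifies t C" using F by (simp add: uhit_def)
    \<comment> \<open>Both sides say that all of \<open>E\<close> is false and \<open>x\<close>,
      \<open>y\<close> are not both true.\<close>
    have eqv: "(\<exists>C\<in>nfs_pair E x y. falsifies t C) \<longleftrightarrow> (\<exists>C\<in>nfs_flip_pair E x y. falsifies t C)"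
      using x y by (auto simp: nfs_pair_def nfs_flip_pair_def falsifies_def lit_true_uminus)
    have uniq: "C = D" if "C \<in> nfs_flip_pair E x y" "D \<in> nfs_flip_pair E x y"
      "falsifies t C" "falsifies t D" for C D
      using that y by (auto simp: nfs_flip_pair_def falsifies_def lit_true_uminus)
    show ?thesis
    proof (cases "\<exists>C\<in>nfs_pair E x y. falsifies t C")
      case True
      then obtain D where D: "D \<in> nfs_flip_pair E x y" "falsifies t D" using eqv by blast
      have "C = D" if "C \<in> ?F'" "falsifies t C" for C
        using that True one uniq[OF _ D(1) _ D(2)] pair by blast
      then show ?thesis using D by blast
    next
      case False
      then show ?thesis using eqv one by blast
    qed
  qed
  ultimately show ?thesis by (simp add: uhit_def)
qed

text \<open>The map \<open>f\<close> from old to new clauses is injective and loses only an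
  occurrence of \<open>- x\<close>, so two occurrences of any other literal in \<open>F\<close> give
  two in \<open>F'\<close>.\<close>

lemma nfs_flip_ldeg_eq_1:
  assumes F: "uhit F" "nonsingular F"
    and pair: "nfs_pair E x y \<subseteq> F" and disj: "nfs_flip_pair E x y \<inter> F = {}"
    and deg: "ldeg ((F - nfs_pair E x y) \<union> nfs_flip_pair E x y) z = 1"
  shows "z = - x"
proof (rule ccontr)
  let ?F' = "(F - nfs_pair E x y) \<union> nfs_flip_pair E x y"
  assume z: "z \<noteq> - x"
  define f where "f C = (if C = E \<union> {x} then E \<union> {x, - y}
    else if C = E \<union> {- x, y} then E \<union> {y} else C)" for C
  have ne: "E \<union> {x, - y} \<noteq> E \<union> {y}" if "E \<union> {x} \<noteq> E \<union> {- x, y}"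
  proof
    assume eq: "E \<union> {x, - y} = E \<union> {y}"
    have "E \<union> {x} \<subseteq> E \<union> {- x, y}" using eq by blast
    then show False
      using uhit_subset_eq[OF F(1)] pair that by (auto simp: nfs_pair_def)
  qed
  have inj: "f C \<noteq> f D" if "C \<in> F" "D \<in> F" "C \<noteq> D" for C D
    using that ne disj by (auto simp: f_def nfs_flip_pair_def)
  have mem: "f C \<in> ?F'" if "C \<in> F" for C
    using that by (auto simp: f_def nfs_pair_def nfs_flip_pair_def)
  have zf: "z \<in> f C" if "z \<in> C" for C
    using that z by (auto simp: f_def)
  obtain A where A: "A \<in> ?F'" "z \<in> A" using deg ldeg_eq_1_iff by blast
  \<comment> \<open>Only \<open>- y\<close> is added to a clause by the flip, and it occurs in
    \<open>F\<close> as the complement of \<open>y\<close>.\<close>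
  have "\<exists>B\<in>F. z \<in> B"
  proof (cases "z = - y")
    case True
    then show ?thesis
      using uhit_complement_occurs[OF F(1), of "E \<union> {- x, y}" y] pair by (auto simp: nfs_pair_def)
  next
    case False
    have C: "E \<union> {x} \<in> F" "E \<union> {- x, y} \<in> F" using pair by (auto simp: nfs_pair_def)
    consider "A \<in> F" | "A = E \<union> {x, - y}" | "A = E \<union> {y}"
      using A(1) unfolding nfs_flip_pair_def by blast
    then show ?thesis
    proof cases
      case 1
      then show ?thesis using A(2) by blast
    next
      case 2
      then have "z \<in> E \<union> {x}" using A(2) False by simp
      then show ?thesis using C(1) by (rule bexI)
    next
      case 3
      then have "z \<in> E \<union> {- x, y}" using A(2) by simp
      then show ?thesis using C(2) by (rule bexI)
    qed
  qed
  then obtain B where B: "B \<in> F" "z \<in> B" by blast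
  then obtain D where D: "D \<in> F" "D \<noteq> B" "z \<in> D"
    using nonsingular_second_occurrence[OF F] by blast
  have "f D \<noteq> f B" using inj[OF D(1) B(1) D(2)] .
  moreover have "f B \<in> ?F' \<and> z \<in> f B" "f D \<in> ?F' \<and> z \<in> f D"
    using mem[OF B(1)] zf[OF B(2)] mem[OF D(1)] zf[OF D(3)] by simp_all
  ultimately show False using deg unfolding ldeg_eq_1_iff by blast
qed

section \<open>Singular DP-reduction\<close>

lemma DP_abs:
  "DP \<bar>x\<bar> F = {(A \<union> B) - {x, - x} | A B. A \<in> F \<and> B \<in> F \<and> A \<inter> compl B = {x}}
    \<union> {A \<in> F. x \<notin> A \<and> - x \<notin> A}"
proof -
  \<comment> \<open>Exchanging the parent clauses negates the resolution literal, so
    \<open>x\<close> may have either sign.\<close>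
  have swap: "A \<inter> compl B = {v} \<longleftrightarrow> B \<inter> compl A = {- v}" for A B :: cls and v
  proof -
    have "w \<in> B \<inter> compl A \<longleftrightarrow> - w \<in> A \<inter> compl B" for w
      unfolding compl_def by force
    then have "B \<inter> compl A = uminus ` (A \<inter> compl B)" by force
    moreover from this have "A \<inter> compl B = uminus ` (B \<inter> compl A)" by (simp add: image_image)
    ultimately show ?thesis by (metis image_empty image_insert minus_minus)
  qed
  have "\<bar>x\<bar> \<notin> var_cl A \<longleftrightarrow> x \<notin> A \<and> - x \<notin> A" for A
    unfolding var_cl_def image_iff by (metis abs_eq_iff abs_minus_cancel)
  moreover define R where
    "R v = {(A \<union> B) - {v, - v} | A B. A \<in> F \<and> B \<in> F \<and> A \<inter> compl B = {v}}" for v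
  have R_uminus: "R (- v) \<subseteq> R v" for v
  proof
    fix D assume "D \<in> R (- v)"
    then obtain A B where AB: "A \<in> F" "B \<in> F" "A \<inter> compl B = {- v}" "D = A \<union> B - {- v, - (- v)}"
      unfolding R_def by blast
    have "D = B \<union> A - {v, - v}" using AB(4) by auto
    moreover have "B \<inter> compl A = {v}" using AB(3) swap[of B A v] by simp
    ultimately show "D \<in> R v" using AB(1,2) unfolding R_def by blast
  qed
  have "R \<bar>x\<bar> = R x" using R_uminus[of x] R_uminus[of "- x"] by (cases "x > 0") auto
  ultimately show ?thesis unfolding DP_def R_def by simp
qed

text \<open>Terminology: \<open>P\<close> is the main clause of the singular variable \<open>\<bar>x\<bar>\<close>, and the clauses
  containing \<open>x\<close> are its side clauses.\<close>

locale uhit_singular =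
  fixes F :: clsset and P :: cls and x :: lit
  assumes uhit: "uhit F" and P: "P \<in> F" "- x \<in> P"
    and P_unique: "\<And>B. B \<in> F \<Longrightarrow> - x \<in> B \<Longrightarrow> B = P"
begin

abbreviation K :: cls where "K \<equiv> P - {- x}"

lemma cl: "A \<in> F \<Longrightarrow> is_clause A"
  using uhit uhit_is_clause by blast

lemma x_nz: "x \<noteq> 0"
  using is_clauseD[OF cl[OF P(1)] P(2)] by simp

lemma x_notin_P: "x \<notin> P"
  using is_clauseD[OF cl[OF P(1)] P(2)] by simp

lemma K_subset_side_clause:
  assumes A: "A \<in> F" "x \<in> A"
  shows "K \<subseteq> A"
proof
  fix z assume z: "z \<in> K"
  show "z \<in> A"
  proof (rule ccontr)
    assume "z \<notin> A"
    \<comment> \<open>The inner override makes \<open>z\<close> true; falsifying \<open>A\<close>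
      cannot undo this, as \<open>z\<close> is not in \<open>A\<close>.\<close>
    let ?t = "override A (override {- z} (\<lambda>_. False))"
    have nz: "z \<noteq> 0" using z cl[OF P(1)] is_clauseD by blast
    have cz: "is_clause {- z}" using nz by (simp add: is_clause_singleton)
    have "lit_true ?t z"
      using \<open>z \<notin> A\<close> nz by (auto simp: lit_true_override[OF cl[OF A(1)] nz] lit_true_override[OF cz nz])
    moreover obtain D where "D \<in> F" "- x \<in> D" "falsifies ?t (D - {- x})"
      using uhit_flip_literal[OF uhit A falsifies_override[OF cl[OF A(1)]]] by blast
    then have "falsifies ?t K" using P_unique by blast
    ultimately show False using z by (auto simp: falsifies_def)
  qed
qed

text \<open>Since \<open>K\<close> is contained in every side clause \<open>A\<close>, the clauses
  \<open>A\<close> and \<open>P\<close> clash in \<open>x\<close> only, and their resolvent is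
  \<open>A\<close> without \<open>x\<close>.\<close>

lemma DP_eq: "DP \<bar>x\<bar> F = {A - {x} | A. A \<in> F \<and> x \<in> A} \<union> {A \<in> F. x \<notin> A \<and> - x \<notin> A}"
proof -
  have clash: "A \<inter> compl B = {x} \<longleftrightarrow> x \<in> A \<and> B = P" if AB: "A \<in> F" "B \<in> F" for A B
  proof
    assume "A \<inter> compl B = {x}"
    then have "x \<in> A" "x \<in> compl B" by auto
    then show "x \<in> A \<and> B = P" using P_unique AB by (auto simp: compl_def)
  next
    assume AP: "x \<in> A \<and> B = P"
    have "w = x" if "w \<in> A" "- w \<in> P" for w
    proof (rule ccontr)
      assume "w \<noteq> x"
      then have "- w \<in> K" using that(2) by simp
      then have "- w \<in> A" using K_subset_side_clause AB(1) AP by blast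
      then show False using is_clauseD(2)[OF cl[OF AB(1)] that(1)] by simp
    qed
    moreover have "w \<in> compl P \<longleftrightarrow> - w \<in> P" for w
      unfolding compl_def by force
    ultimately show "A \<inter> compl B = {x}" using AP P(2) by blast
  qed
  have res: "A \<union> P - {x, - x} = A - {x}" if "A \<in> F" "x \<in> A" for A
    using K_subset_side_clause[OF that] is_clauseD[OF cl[OF that(1)] that(2)] x_notin_P by auto
  have "{(A \<union> B) - {x, - x} | A B. A \<in> F \<and> B \<in> F \<and> A \<inter> compl B = {x}}
      = {A - {x} | A. A \<in> F \<and> x \<in> A}" (is "?L = ?R")
  proof
    show "?L \<subseteq> ?R"
    proof
      fix D assume "D \<in> ?L"
      then obtain A B where AB: "A \<in> F" "B \<in> F" "A \<inter> compl B = {x}" "D = A \<union> B - {x, - x}"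
        by blast
      then have "x \<in> A" "B = P" using clash by auto
      then show "D \<in> ?R" using AB res by auto
    qed
    show "?R \<subseteq> ?L"
    proof
      fix D assume "D \<in> ?R"
      then obtain A where A: "A \<in> F" "x \<in> A" "D = A - {x}" by blast
      then have "D = A \<union> P - {x, - x}" "A \<inter> compl P = {x}"
        using res clash P(1) by auto
      then show "D \<in> ?L" using A(1) P(1) by blast
    qed
  qed
  then show ?thesis by (simp add: DP_abs)
qed

lemma remove_x_inj:
  assumes "A \<in> F" "B \<in> F" "A - {x} = B - {x}"
  shows "A = B"
proof -
  have "A \<subseteq> B \<or> B \<subseteq> A" using assms(3) by blast
  then show ?thesis using uhit_subset_eq[OF uhit] assms(1,2) by blast
qed

lemma remove_x_in_DP: "A \<in> F \<Longrightarrow> A \<noteq> P \<Longrightarrow> A - {x} \<in> DP \<bar>x\<bar> F"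
  using P_unique unfolding DP_eq by (cases "x \<in> A") auto

text \<open>Each remaining literal needs two occurrences outside the dropped clause
  \<open>P\<close>. A literal of \<open>K\<close> occurs in all side clauses, of which there are at
  least two; for a literal outside \<open>P\<close>, its occurrences in \<open>F\<close> avoid
  \<open>P\<close> anyway.\<close>

lemma nonsingular_DP:
  assumes deg: "\<And>z. z \<noteq> - x \<Longrightarrow> ldeg F z \<noteq> 1"
  shows "nonsingular (DP \<bar>x\<bar> F)"
proof (rule nonsingularI, rule notI)
  fix z assume z1: "ldeg (DP \<bar>x\<bar> F) z = 1"
  have second: "\<exists>B\<in>F. B \<noteq> A \<and> w \<in> B" if "A \<in> F" "w \<in> A" "w \<noteq> - x" for A w
    using deg[OF that(3)] that(1,2) unfolding ldeg_eq_1_iff by blast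
  obtain D where D: "D \<in> DP \<bar>x\<bar> F" "z \<in> D"
    using z1 unfolding ldeg_eq_1_iff by blast
  have "\<exists>A\<in>F. z \<in> A \<and> z \<noteq> x \<and> z \<noteq> - x"
  proof (cases "D \<in> F \<and> x \<notin> D \<and> - x \<notin> D")
    case True
    then show ?thesis using D(2) by blast
  next
    case False
    then obtain A where A: "A \<in> F" "x \<in> A" "D = A - {x}" using D(1) unfolding DP_eq by blast
    have "- x \<notin> A" using is_clauseD(2)[OF cl[OF A(1)] A(2)] .
    then show ?thesis using A D(2) by blast
  qed
  then obtain A where A: "A \<in> F" "z \<in> A" "z \<noteq> x" "z \<noteq> - x" by blast
  have "\<exists>B C. B \<in> F \<and> C \<in> F \<and> B \<noteq> C \<and> B \<noteq> P \<and> C \<noteq> P \<and> z \<in> B \<and> z \<in> C"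
  proof (cases "z \<in> P")
    case True
    obtain B where B: "B \<in> F" "x \<in> B"
      using uhit_complement_occurs[OF uhit P] by auto
    have "x \<noteq> - x" using x_nz by simp
    then obtain C where C: "C \<in> F" "C \<noteq> B" "x \<in> C" using second[OF B] by blast
    have "z \<in> B" "z \<in> C"
      using K_subset_side_clause[OF B] K_subset_side_clause[OF C(1,3)] True A(4) by auto
    then show ?thesis using B C x_notin_P by metis
  next
    case False
    then show ?thesis using second[OF A(1,2,4)] A(1,2) by metis
  qed
  then obtain B C where BC: "B \<in> F" "C \<in> F" "B \<noteq> C" "B \<noteq> P" "C \<noteq> P" "z \<in> B" "z \<in> C"
    by blast
  have "B - {x} \<noteq> C - {x}" using remove_x_inj BC by blast
  moreover have "B - {x} \<in> DP \<bar>x\<bar> F" "C - {x} \<in> DP \<bar>x\<bar> F" using remove_x_in_DP BC by blast+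
  moreover have "z \<in> B - {x}" "z \<in> C - {x}" using BC A(3) by auto
  ultimately show False using z1 unfolding ldeg_eq_1_iff by metis
qed

section \<open>Clause-factorisation of the reduced clause-set\<close>

definition G0 :: clsset where "G0 = insert K {A \<in> F. x \<notin> A \<and> - x \<notin> A}"

definition H :: clsset where "H = {A - {x} - K | A. A \<in> F \<and> x \<in> A}"

lemma K_notin_F: "K \<notin> F"
  using uhit_subset_eq[OF uhit _ P(1), of K] P(2) by blast

lemma is_clause_set_H: "is_clause_set H"
proof -
  have "finite F" using uhit by (auto simp: uhit_def is_clause_set_def)
  moreover have "H = (\<lambda>A. A - {x} - K) ` {A \<in> F. x \<in> A}" by (auto simp: H_def)
  ultimately have "finite H" by simp
  moreover have "is_clause B" if B: "B \<in> H" for B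
  proof -
    obtain A where A: "A \<in> F" "B = A - {x} - K" using B unfolding H_def by blast
    then have "B \<subseteq> A" by blast
    then show ?thesis using is_clause_subset[OF cl[OF A(1)]] by blast
  qed
  ultimately show ?thesis by (simp add: is_clause_set_def)
qed

lemma unsatisfiable_H: "\<not> satisfiable H"
proof -
  have "\<exists>B\<in>H. falsifies t B" for t
  proof -
    let ?s = "override P t"
    have "falsifies ?s P" using falsifies_override[OF cl[OF P(1)]] .
    \<comment> \<open>Flipping \<open>x\<close> yields an assignment that falsifies a side clause; outside the variables
      of \<open>P\<close> it agrees with \<open>t\<close>.\<close>
    then obtain A where A: "A \<in> F" "x \<in> A" "falsifies ?s (A - {x})"
      using uhit_flip_literal[OF uhit P] by auto
    have "\<not> lit_true t w" if w: "w \<in> A - {x} - K" for w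
    proof -
      have nz: "w \<noteq> 0" and nw: "- w \<notin> A" using w is_clauseD[OF cl[OF A(1)]] by auto
      have "\<not> lit_true ?s w" using A(3) w by (auto simp: falsifies_def)
      moreover have "w \<notin> P"
        using w is_clauseD(2)[OF cl[OF A(1)] A(2)] by auto
      ultimately show ?thesis using lit_true_override[OF cl[OF P(1)] nz] by blast
    qed
    then show ?thesis using A(1,2) by (auto simp: falsifies_def H_def)
  qed
  then show ?thesis using unsatisfiable_iff_falsifies[OF is_clause_set_H] by blast
qed

text \<open>The compatibility condition in the product always holds here: \<open>K\<close> and the
  remainder of \<open>A\<close> lie in the same clause \<open>A\<close>.\<close>

lemma clause_prod_part_K_H: "clause_prod_part K H = {A - {x} | A. A \<in> F \<and> x \<in> A}"
proof -
  have eq: "K \<union> (A - {x} - K) = A - {x}" "K \<inter> compl (A - {x} - K) = {}"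
    if A: "A \<in> F" "x \<in> A" for A
  proof -
    have sub: "K \<subseteq> A" using K_subset_side_clause[OF A] .
    then show "K \<union> (A - {x} - K) = A - {x}" using x_notin_P by auto
    show "K \<inter> compl (A - {x} - K) = {}"
      using sub is_clauseD(2)[OF cl[OF A(1)]] by (auto simp: compl_def)
  qed
  show ?thesis
  proof
    show "clause_prod_part K H \<subseteq> {A - {x} | A. A \<in> F \<and> x \<in> A}"
      using eq(1) unfolding clause_prod_part_def H_def by blast
    show "{A - {x} | A. A \<in> F \<and> x \<in> A} \<subseteq> clause_prod_part K H"
    proof
      fix D assume "D \<in> {A - {x} | A. A \<in> F \<and> x \<in> A}"
      then obtain A where A: "A \<in> F" "x \<in> A" "D = A - {x}" by blast
      then have "D = K \<union> (A - {x} - K)" "A - {x} - K \<in> H"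
        using eq(1) by (auto simp: H_def)
      then show "D \<in> clause_prod_part K H"
        using eq(2)[OF A(1,2)] unfolding clause_prod_part_def by blast
    qed
  qed
qed

lemma DP_eq_clause_prod: "DP \<bar>x\<bar> F = clause_prod G0 K H"
  using K_notin_F unfolding clause_prod_def clause_prod_part_K_H DP_eq G0_def by blast

text \<open>A variable common to \<open>K\<close> and \<open>H\<close> would occur twice in one side
  clause. The union is disjoint because \<open>A - {x}\<close>, a proper subset of a clause of
  \<open>F\<close>, is not in \<open>F\<close>.\<close>

lemma clause_factorisation_DP: "clause_factorisation G0 K H"
proof -
  have fin: "finite F" using uhit by (auto simp: uhit_def is_clause_set_def)
  have "is_clause_set G0"
    using fin cl is_clause_subset[OF cl[OF P(1)], of K] by (auto simp: is_clause_set_def G0_def)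
  moreover have "var_cl K \<inter> var_cls H = {}"
  proof -
    have False if "a \<in> K" "A \<in> F" "x \<in> A" "b \<in> A - {x} - K" "\<bar>a\<bar> = \<bar>b\<bar>" for a b A
    proof -
      have "a \<in> A" using K_subset_side_clause that by blast
      moreover have "b = - a" using that by (auto simp: abs_eq_iff)
      ultimately show False using is_clauseD(2)[OF cl[OF that(2)]] that(4) by blast
    qed
    then show ?thesis unfolding var_cl_def var_cls_def H_def by blast
  qed
  moreover have "A - {x} \<notin> F" if "A \<in> F" "x \<in> A" for A
    using uhit_subset_eq[OF uhit _ that(1), of "A - {x}"] that by blast
  then have "(G0 - {K}) \<inter> clause_prod_part K H = {}"
    unfolding clause_prod_part_K_H G0_def by blast
  ultimately show ?thesis
    using unsatisfiable_H is_clause_set_H by (simp add: clause_factorisation_def G0_def)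
qed

end

section \<open>Singularity index and normal form\<close>

lemma sDP_step_nonsingular: "nonsingular F \<Longrightarrow> \<not> sDP_step F G"
  by (auto simp: sDP_step_def nonsingular_def)

lemma singind_nonsingular:
  assumes "nonsingular F"
  shows "singind F = 0"
  unfolding singind_def
proof (rule the_equality)
  show "\<exists>G. (sDP_step ^^ 0) F G \<and> nonsingular G" using assms by auto
next
  fix n assume "\<exists>G. (sDP_step ^^ n) F G \<and> nonsingular G"
  then obtain G where "(sDP_step ^^ n) F G" by blast
  then show "n = 0"
    using sDP_step_nonsingular[OF assms] by (cases n) (auto simp del: relpowp.simps(2) dest!: relpowp_Suc_D2)
qed

text \<open>With a single possible first step, ending in a nonsingular set, both definite
  descriptions have unique witnesses; no general confluence result is required.\<close>

lemma singind_sNF_unique_step: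
  assumes step: "\<And>G'. sDP_step F G' \<longleftrightarrow> G' = G" and G: "nonsingular G"
  shows "singind F = 1" "sNF F = G"
proof -
  have F: "\<not> nonsingular F" using step sDP_step_nonsingular by blast
  have only: "n = 1 \<and> G' = G" if n: "(sDP_step ^^ n) F G'" "nonsingular G'" for n G'
  proof (cases n)
    case 0
    then show ?thesis using n F by auto
  next
    case (Suc m)
    then have "(sDP_step ^^ m) G G'" using n(1) step by (metis relpowp_Suc_D2)
    then have "m = 0 \<and> G' = G"
      using sDP_step_nonsingular[OF G] by (cases m) (auto simp del: relpowp.simps(2) dest!: relpowp_Suc_D2)
    then show ?thesis using Suc by simp
  qed
  have one: "(sDP_step ^^ 1) F G" using step by auto
  show "singind F = 1"
    unfolding singind_def by (rule the_equality) (use one G only in blast)+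
  show "sNF F = G"
    unfolding sNF_def
    by (rule the_equality) (use one G only in \<open>unfold rtranclp_power, blast+\<close>)
qed

theorem lemma23:
  fixes F F' :: clsset
  assumes "is_clause_set F" and "\<not> satisfiable F" and "hitting F" and "nonsingular F"
    and "nfs_flip F F'"
  shows "singind F' \<le> 1 \<and>
    (\<not> fs_resolvable F \<and> singind F' = 1 \<longrightarrow>
      (\<exists>G0 C H. nontrivial_clause_factorisation G0 C H \<and> sNF F' = clause_prod G0 C H \<and>
        var_cls G0 \<inter> var_cls H \<noteq> {}))"
proof -
  obtain E x y where cond: "nfs_cond E x y" and pair: "nfs_pair E x y \<subseteq> F"
    and disj: "nfs_flip_pair E x y \<inter> F = {}"
    and F': "F' = (F - nfs_pair E x y) \<union> nfs_flip_pair E x y"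
    using assms(5) by (auto simp: nfs_flip_def)
  have E: "is_clause E" and x: "x \<noteq> 0" and y: "y \<noteq> 0" "y \<noteq> x" "y \<noteq> - x"
    and notin: "x \<notin> E" "- x \<notin> E" "y \<notin> E" "- y \<notin> E"
    using cond by (auto simp: nfs_cond_def is_lit_def)
  have uF: "uhit F" using uhit_if_unsatisfiable_hitting assms by blast
  have uF': "uhit F'" using nfs_flip_uhit[OF uF cond pair] F' by simp
  have deg: "ldeg F' z \<noteq> 1" if "z \<noteq> - x" for z
    using nfs_flip_ldeg_eq_1[OF uF assms(4) pair disj] F' that by blast
  show ?thesis
  proof (cases "ldeg F' (- x) = 1")
    case False
    then have "nonsingular F'" using deg nonsingularI by metis
    then show ?thesis by (simp add: singind_nonsingular)
  next
    case True
    then obtain P where P: "P \<in> F'" "- x \<in> P" and P_unique: "\<And>B. B \<in> F' \<Longrightarrow> - x \<in> B \<Longrightarrow> B = P"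
      unfolding ldeg_eq_1_iff by blast
    interpret uhit_singular F' P x
      using uF' P P_unique by unfold_locales
    \<comment> \<open>Every literal except \<open>- x\<close> has degree different from 1, so only
      one reduction is possible.\<close>
    have "singular_var F' v \<longleftrightarrow> v = \<bar>x\<bar>" for v
    proof
      assume "singular_var F' v"
      then have "v \<ge> 0" "v = - x \<or> v = x"
        using singular_varD deg[of v] deg[of "- v"] by auto
      then show "v = \<bar>x\<bar>" by auto
    next
      assume "v = \<bar>x\<bar>"
      then show "singular_var F' v" using uhit_singular_varI[OF uF' True] by simp
    qed
    then have step: "sDP_step F' G' \<longleftrightarrow> G' = DP \<bar>x\<bar> F'" for G'
      by (simp add: sDP_step_def)
    note nf = singind_sNF_unique_step[OF step nonsingular_DP[OF deg]]
    have D1: "E \<union> {x, - y} \<in> F'" and D2: "E \<union> {y} \<in> F'"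
      by (auto simp: F' nfs_flip_pair_def)
    \<comment> \<open>Neither flip clause contains \<open>- x\<close>, so \<open>P\<close> is an old
      clause that survived the flip.\<close>
    have PF: "P \<in> F" "P \<noteq> E \<union> {- x, y}"
      using P x y notin by (auto simp: F' nfs_pair_def nfs_flip_pair_def)
    have KE: "K \<subseteq> E \<union> {- y}"
      using K_subset_side_clause[OF D1] x_notin_P by auto
    obtain w where w: "w \<in> P" "- w \<in> E \<union> {- x, y}"
    proof -
      have "E \<union> {- x, y} \<in> F" using pair by (simp add: nfs_pair_def)
      then have "\<exists>w\<in>P. - w \<in> E \<union> {- x, y}"
        using assms(3)[unfolded hitting_def, rule_format, OF PF(1) _ PF(2)] by (simp only:)
      then show ?thesis using that by (elim bexE)
    qed
    \<comment> \<open>The clash of \<open>P\<close> with the removed clause is neither in the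
      variable of \<open>x\<close> nor inside \<open>E\<close>, which leaves
      \<open>- y\<close>.\<close>
    have yK: "- y \<in> K"
    proof -
      have "w \<noteq> x" using w(1) x_notin_P by blast
      moreover have "w \<noteq> - x" using w(2) x y notin by auto
      ultimately have "w \<in> E \<union> {- y}" "- w \<in> E \<union> {y}" using w KE by auto
      then have "w = - y" using is_clauseD(2)[OF E] notin by auto
      then show ?thesis using w(1) y by auto
    qed
    obtain A where A: "A \<in> F'" "x \<in> A" "A \<noteq> E \<union> {x, - y}"
      using deg[of x] x D1 unfolding ldeg_eq_1_iff by auto
    have "\<not> E \<subseteq> K"
    proof
      assume "E \<subseteq> K"
      then have "E \<union> {x, - y} \<subseteq> A" using K_subset_side_clause[OF A(1,2)] yK A(2) by auto
      then show False using uhit_subset_eq[OF uF' D1 A(1)] A(3) by blast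
    qed
    then obtain u where u: "u \<in> E" "u \<notin> K" by blast
    \<comment> \<open>As \<open>- y\<close> is in \<open>K\<close>, this member of \<open>H\<close>
      is just \<open>E - K\<close>.\<close>
    define B where "B = (E \<union> {x, - y}) - {x} - K"
    have "u \<in> B" using u notin by (auto simp: B_def)
    moreover have "B \<in> H" using D1 unfolding H_def B_def by blast
    ultimately have uH: "\<bar>u\<bar> \<in> var_cls H" "H \<noteq> {{}}"
      unfolding var_cls_def var_cl_def by blast+
    have "E \<union> {y} \<in> G0" using D2 notin y by (auto simp: G0_def)
    then have "\<bar>u\<bar> \<in> var_cls G0" using u(1) unfolding var_cls_def var_cl_def by blast
    moreover have "G0 \<noteq> {{}}" using yK by (auto simp: G0_def)
    ultimately have "nontrivial_clause_factorisation G0 K H \<and> sNF F' = clause_prod G0 K H \<and>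
        var_cls G0 \<inter> var_cls H \<noteq> {}"
      using clause_factorisation_DP uH nf(2) DP_eq_clause_prod
      by (auto simp: nontrivial_clause_factorisation_def)
    moreover have "singind F' \<le> 1" using nf(1) by simp
    ultimately show ?thesis by blast
  qed
qed

end
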